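(* A set $\Gamma$ of cathoristic logic formulae is satisfiable if and only if every finite subset of $\Gamma$ is satisfiable.
   Context: Fix a non-empty set $\Sigma$ of actions. Formulae: $\phi ::= \top \mid \phi\land\psi \mid \langle a\rangle\phi \mid\ !A$ with $a\in\Sigma$, $A$ a finite subset of $\Sigma$. A cathoristic transition system is $\mathcal{L}=(S,\rightarrow,\lambda)$ with $\rightarrow\subseteq S\times\Sigma\times S$ deterministic ($s\xrightarrow{a}t$ and $s\xrightarrow{a}t'$ imply $t=t'$) and $\lambda:S\to\mathcal{P}(\Sigma)$ such that (admissibility) $\{a\mid\exists t.\,s\xrightarrow{a}t\}\subseteq\lambda(s)$ and (well-sizedness) each $\lambda(s)$ is finite or equal to $\Sigma$; a cathoristic model is $(\mathcal{L},s)$, $s\in S$. Satisfaction: $\top$ always; $\land$ componentwise; $(\mathcal{L},s)\models\langle a\rangle\phi$ iff some $s\xrightarrow{a}t$ has $(\mathcal{L},t)\models\phi$; $(\mathcal{L},s)\models\ !A$ iff $\lambda(s)\subseteq A$. A set $\Gamma$ of formulae is satisfiable if there is a cathoristic model $\mathfrak{M}$ with $\mathfrak{M}\models\phi$ for all $\phi\in\Gamma$. *)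

theory Defs
  imports Main "HOL-Library.FSet"
begin

(* The non-empty set of actions (Sigma) is the type 'a; Sigma itself is UNIV. *)

datatype 'a fml =
    Top
  | And "'a fml" "'a fml"
  | May 'a "'a fml"
  | Bang "'a fset"

record ('s, 'a) cts =
  states :: "'s set"
  steps :: "('s \<times> 'a \<times> 's) set"
  lab :: "'s \<Rightarrow> 'a set"

definition deterministic :: "('s, 'a) cts \<Rightarrow> bool" where
  "deterministic L \<longleftrightarrow>
     (\<forall>s a t t'. (s, a, t) \<in> steps L \<and> (s, a, t') \<in> steps L \<longrightarrow> t = t')"

definition admissible :: "('s, 'a) cts \<Rightarrow> bool" where
  "admissible L \<longleftrightarrow> (\<forall>s \<in> states L. {a. \<exists>t. (s, a, t) \<in> steps L} \<subseteq> lab L s)"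

definition well_sized :: "('s, 'a) cts \<Rightarrow> bool" where
  "well_sized L \<longleftrightarrow> (\<forall>s \<in> states L. finite (lab L s) \<or> lab L s = UNIV)"

definition cathoristic_ts :: "('s, 'a) cts \<Rightarrow> bool" where
  "cathoristic_ts L \<longleftrightarrow>
     steps L \<subseteq> states L \<times> UNIV \<times> states L \<and>
     deterministic L \<and> admissible L \<and> well_sized L"

definition cathoristic_model :: "('s, 'a) cts \<Rightarrow> 's \<Rightarrow> bool" where
  "cathoristic_model L s \<longleftrightarrow> cathoristic_ts L \<and> s \<in> states L"

primrec satisfies :: "('s, 'a) cts \<Rightarrow> 's \<Rightarrow> 'a fml \<Rightarrow> bool" where
  "satisfies L s Top \<longleftrightarrow> True"
| "satisfies L s (And \<phi> \<psi>) \<longleftrightarrow> satisfies L s \<phi> \<and> satisfies L s \<psi>"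
| "satisfies L s (May a \<phi>) \<longleftrightarrow> (\<exists>t. (s, a, t) \<in> steps L \<and> satisfies L t \<phi>)"
| "satisfies L s (Bang A) \<longleftrightarrow> lab L s \<subseteq> fset A"

(* A definition cannot quantify over types, so the states of the model are drawn from
   the type 'a list (the carrier being an arbitrary subset of it). This loses no
   generality: by unravelling, a set with a model over any state type whatsoever
   also has one over 'a list; see satisfiableI below. *)

definition satisfiable :: "'a fml set \<Rightarrow> bool" where
  "satisfiable \<Gamma> \<longleftrightarrow>
     (\<exists>(L :: ('a list, 'a) cts) s. cathoristic_model L s \<and> (\<forall>\<phi> \<in> \<Gamma>. satisfies L s \<phi>))"

inductive path :: "('s, 'a) cts \<Rightarrow> 's \<Rightarrow> 'a list \<Rightarrow> 's \<Rightarrow> bool" for L s where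
  path_Nil: "path L s [] s"
| path_snoc: "path L s w t \<Longrightarrow> (t, a, u) \<in> steps L \<Longrightarrow> path L s (w @ [a]) u"

lemma path_Nil_iff [simp]: "path L s [] t \<longleftrightarrow> t = s"
  by (subst path.simps) auto

lemma path_snoc_iff [simp]:
  "path L s (w @ [a]) u \<longleftrightarrow> (\<exists>t. path L s w t \<and> (t, a, u) \<in> steps L)"
  by (subst path.simps) auto

lemma path_unique:
  assumes "deterministic L"
  shows "path L s w t \<Longrightarrow> path L s w t' \<Longrightarrow> t = t'"
proof (induction w arbitrary: t t' rule: rev_induct)
  case (snoc a w)
  then show ?case using assms unfolding deterministic_def by (metis path_snoc_iff)
qed simp

lemma path_states:
  "cathoristic_model L s \<Longrightarrow> path L s w t \<Longrightarrow> t \<in> states L"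
  by (cases w rule: rev_cases) (auto simp: cathoristic_model_def cathoristic_ts_def)

definition unravel :: "('s, 'a) cts \<Rightarrow> 's \<Rightarrow> ('a list, 'a) cts" where
  "unravel L s =
     \<lparr>states = {w. \<exists>t. path L s w t},
      steps = {(w, a, w @ [a]) | w a. \<exists>t. path L s (w @ [a]) t},
      lab = (\<lambda>w. lab L (THE t. path L s w t))\<rparr>"

lemma lab_unravel:
  "deterministic L \<Longrightarrow> path L s w t \<Longrightarrow> lab (unravel L s) w = lab L t"
  unfolding unravel_def by (simp, metis path_unique the_equality)

lemma cathoristic_model_unravel:
  assumes "cathoristic_model L s"
  shows "cathoristic_model (unravel L s) []"
proof -
  have det: "deterministic L" and adm: "admissible L" and ws: "well_sized L"
    using assms by (auto simp: cathoristic_model_def cathoristic_ts_def)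
  have "deterministic (unravel L s)"
    by (auto simp: deterministic_def unravel_def)
  moreover have "steps (unravel L s) \<subseteq> states (unravel L s) \<times> UNIV \<times> states (unravel L s)"
    by (auto simp: unravel_def intro: path_snoc)
  moreover have "admissible (unravel L s)"
    unfolding admissible_def
  proof (intro ballI subsetI)
    fix w a
    assume w: "w \<in> states (unravel L s)" and a: "a \<in> {a. \<exists>v. (w, a, v) \<in> steps (unravel L s)}"
    from a obtain t u where t: "path L s w t" "(t, a, u) \<in> steps L"
      by (auto simp: unravel_def)
    then have "a \<in> lab L t"
      using adm path_states[OF assms t(1)] by (auto simp: admissible_def)
    then show "a \<in> lab (unravel L s) w" by (simp add: lab_unravel[OF det t(1)])
  qed
  moreover have "well_sized (unravel L s)"
    unfolding well_sized_def
  proof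
    fix w assume "w \<in> states (unravel L s)"
    then obtain t where t: "path L s w t" by (auto simp: unravel_def)
    show "finite (lab (unravel L s) w) \<or> lab (unravel L s) w = UNIV"
      using ws path_states[OF assms t] by (simp add: lab_unravel[OF det t] well_sized_def)
  qed
  moreover have "[] \<in> states (unravel L s)" by (auto simp: unravel_def intro: path_Nil)
  ultimately show ?thesis by (simp add: cathoristic_model_def cathoristic_ts_def)
qed

lemma satisfies_unravel:
  assumes "deterministic L"
  shows "path L s w t \<Longrightarrow> satisfies (unravel L s) w \<phi> \<longleftrightarrow> satisfies L t \<phi>"
proof (induction \<phi> arbitrary: w t)
  case (May a \<phi>)
  have "satisfies (unravel L s) w (May a \<phi>) \<longleftrightarrow>
      (\<exists>u. path L s (w @ [a]) u) \<and> satisfies (unravel L s) (w @ [a]) \<phi>"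
    by (auto simp: unravel_def)
  also have "\<dots> \<longleftrightarrow> (\<exists>u. path L s (w @ [a]) u \<and> satisfies L u \<phi>)"
    using May.IH by blast
  also have "\<dots> \<longleftrightarrow> (\<exists>u. (t, a, u) \<in> steps L \<and> satisfies L u \<phi>)"
    unfolding path_snoc_iff using May.prems path_unique[OF assms May.prems] by blast
  finally show ?case by simp
qed (simp_all add: lab_unravel[OF assms])

lemma satisfiableI:
  fixes L :: "('s, 'a) cts"
  assumes "cathoristic_model L s" and "\<And>\<phi>. \<phi> \<in> \<Gamma> \<Longrightarrow> satisfies L s \<phi>"
  shows "satisfiable \<Gamma>"
proof -
  have "deterministic L"
    using assms(1) by (simp add: cathoristic_model_def cathoristic_ts_def)
  then have "satisfies (unravel L s) [] \<phi>" if "\<phi> \<in> \<Gamma>" for \<phi>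
    using assms(2)[OF that] by (simp add: satisfies_unravel[where t = s])
  then show ?thesis
    using cathoristic_model_unravel[OF assms(1)] unfolding satisfiable_def by blast
qed

end

(* The formulae of \<Gamma> force subformulae to hold at the words over the actions. The tree of all
   words, with exactly the forced transitions and the largest labels that respect the forced
   formulae Bang A, is a model of \<Gamma> as soon as it is admissible. Each forced formula originates
   from a single formula of \<Gamma>, and a conflict involves only two forced formulae at one word
   (May a \<psi> and Bang A with a outside A), so satisfiability of the subsets of \<Gamma> with at most
   two elements already rules it out. *)
theory Submission
  imports Defs
begin

inductive forced :: "'a fml set \<Rightarrow> 'a list \<Rightarrow> 'a fml \<Rightarrow> bool" for \<Gamma> where
  forced_member: "\<phi> \<in> \<Gamma> \<Longrightarrow> forced \<Gamma> [] \<phi>"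
| forced_And1: "forced \<Gamma> w (And \<phi> \<psi>) \<Longrightarrow> forced \<Gamma> w \<phi>"
| forced_And2: "forced \<Gamma> w (And \<phi> \<psi>) \<Longrightarrow> forced \<Gamma> w \<psi>"
| forced_May: "forced \<Gamma> w (May a \<phi>) \<Longrightarrow> forced \<Gamma> (w @ [a]) \<phi>"

text \<open>Every rule has just one premise, so a derivation is a chain and starts from a single
  member of \<open>\<Gamma>\<close>.\<close>

lemma forced_singleton:
  "forced \<Gamma> w \<phi> \<Longrightarrow> \<exists>\<gamma>\<in>\<Gamma>. forced {\<gamma>} w \<phi>"
  by (induction rule: forced.induct) (blast intro: forced.intros)+

text \<open>Determinism is what makes the \<open>May\<close> case work: the successor witnessing
  \<open>May a \<phi>\<close> must be the state that the path reaches.\<close>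

lemma forced_sound:
  assumes "\<And>\<gamma>. \<gamma> \<in> \<Gamma> \<Longrightarrow> satisfies L s \<gamma>" and "deterministic L"
  shows "forced \<Gamma> w \<phi> \<Longrightarrow> path L s w t \<Longrightarrow> satisfies L t \<phi>"
proof (induction arbitrary: t rule: forced.induct)
  case (forced_member \<phi>)
  then show ?case using assms(1) by simp
next
  case (forced_May w a \<phi>)
  from forced_May.prems obtain u where "path L s w u" "(u, a, t) \<in> steps L" by auto
  with forced_May.IH show ?case
    using assms(2) unfolding deterministic_def satisfies.simps by blast
qed auto

text \<open>Supplies the path that \<open>forced_sound\<close> presupposes: a forced
  \<open>May\<close> holds at the end of the path built so far and so extends it.\<close>

lemma forced_path:
  assumes "\<And>\<gamma>. \<gamma> \<in> \<Gamma> \<Longrightarrow> satisfies L s \<gamma>" and "deterministic L"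
  shows "forced \<Gamma> w \<phi> \<Longrightarrow> \<exists>t. path L s w t"
proof (induction rule: forced.induct)
  case (forced_May w a \<phi>)
  then obtain t where t: "path L s w t" by blast
  have "satisfies L t (May a \<phi>)"
    by (rule forced_sound[OF assms forced_May.hyps t])
  with t show ?case by auto
qed auto

text \<open>In a model of \<open>\<Gamma>\<close> both formulae hold at the state reached by
  \<open>w\<close>; admissibility puts \<open>a\<close> into its label, which lies inside
  \<open>A\<close>.\<close>

lemma forced_compatible:
  assumes "satisfiable \<Gamma>" "forced \<Gamma> w (May a \<psi>)" "forced \<Gamma> w (Bang A)"
  shows "a |\<in>| A"
proof -
  obtain L :: "('a list, 'a) cts" and s
    where model: "cathoristic_model L s" and sat: "\<And>\<gamma>. \<gamma> \<in> \<Gamma> \<Longrightarrow> satisfies L s \<gamma>"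
    using assms(1) unfolding satisfiable_def by blast
  have det: "deterministic L" and adm: "admissible L"
    using model by (auto simp: cathoristic_model_def cathoristic_ts_def)
  obtain t where t: "path L s w t"
    using forced_path[OF sat det assms(2)] by blast
  have "satisfies L t (May a \<psi>)" "satisfies L t (Bang A)"
    using forced_sound[OF sat det _ t] assms(2,3) by blast+
  then show ?thesis
    using adm path_states[OF model t] by (auto simp: admissible_def)
qed

definition canonical :: "'a fml set \<Rightarrow> ('a list, 'a) cts" where
  "canonical \<Gamma> =
     \<lparr>states = UNIV,
      steps = {(w, a, w @ [a]) | w a. \<exists>\<psi>. forced \<Gamma> w (May a \<psi>)},
      lab = (\<lambda>w. \<Inter>{fset A | A. forced \<Gamma> w (Bang A)})\<rparr>"

text \<open>Induction on the formula, not on the derivation: the word must vary, since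
  \<open>May\<close> passes to a longer one.\<close>

lemma satisfies_canonical:
  "forced \<Gamma> w \<phi> \<Longrightarrow> satisfies (canonical \<Gamma>) w \<phi>"
proof (induction \<phi> arbitrary: w)
  case (And \<phi> \<psi>)
  then show ?case by (auto intro: forced_And1 forced_And2)
next
  case (May a \<phi>)
  then have "satisfies (canonical \<Gamma>) (w @ [a]) \<phi>" by (blast intro: forced_May)
  then show ?case using May.prems by (auto simp: canonical_def)
qed (auto simp: canonical_def)

text \<open>The assumption is admissibility: it puts \<open>a\<close> into every set of the
  intersection that forms the label.\<close>

lemma cathoristic_model_canonical:
  assumes "\<And>w a \<psi> A. forced \<Gamma> w (May a \<psi>) \<Longrightarrow> forced \<Gamma> w (Bang A) \<Longrightarrow> a |\<in>| A"
  shows "cathoristic_model (canonical \<Gamma>) w"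
proof -
  have "well_sized (canonical \<Gamma>)"
    unfolding well_sized_def
  proof
    fix v
    show "finite (lab (canonical \<Gamma>) v) \<or> lab (canonical \<Gamma>) v = UNIV"
    \<comment> \<open>One forced \<open>Bang A\<close> bounds the label by a finite set; with none,
      the empty intersection is \<open>UNIV\<close>.\<close>
    proof (cases "\<exists>A. forced \<Gamma> v (Bang A)")
      case True
      then obtain A where "forced \<Gamma> v (Bang A)" ..
      then have "lab (canonical \<Gamma>) v \<subseteq> fset A" by (auto simp: canonical_def)
      then show ?thesis by (meson finite_fset finite_subset)
    next
      case False
      then show ?thesis by (simp add: canonical_def)
    qed
  qed
  moreover have "admissible (canonical \<Gamma>)"
    using assms by (auto simp: admissible_def canonical_def)
  ultimately show ?thesis
    by (auto simp: cathoristic_model_def cathoristic_ts_def deterministic_def canonical_def)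
qed

theorem mainTheorem15:
  fixes \<Gamma> :: "'a fml set"
  shows "satisfiable \<Gamma> \<longleftrightarrow> (\<forall>\<Delta>. \<Delta> \<subseteq> \<Gamma> \<and> finite \<Delta> \<longrightarrow> satisfiable \<Delta>)"
proof
  assume "satisfiable \<Gamma>"
  then show "\<forall>\<Delta>. \<Delta> \<subseteq> \<Gamma> \<and> finite \<Delta> \<longrightarrow> satisfiable \<Delta>"
    unfolding satisfiable_def by blast
next
  assume fin: "\<forall>\<Delta>. \<Delta> \<subseteq> \<Gamma> \<and> finite \<Delta> \<longrightarrow> satisfiable \<Delta>"
  \<comment> \<open>Brings the derivations from \<open>{\<beta>}\<close> and
    \<open>{\<gamma>}\<close> together over \<open>{\<beta>, \<gamma>}\<close>, so that one model
    refutes the conflict.\<close>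
  have mono: "forced \<Delta> w \<phi>" if "forced {\<gamma>} w \<phi>" "\<gamma> \<in> \<Delta>" for \<Delta> \<gamma> w and \<phi> :: "'a fml"
    using that by (induction rule: forced.induct) (auto intro: forced.intros)
  have "a |\<in>| A" if may: "forced \<Gamma> w (May a \<psi>)" and bang: "forced \<Gamma> w (Bang A)" for w a \<psi> A
  proof -
    obtain \<beta> \<gamma> where \<beta>\<gamma>: "\<beta> \<in> \<Gamma>" "forced {\<beta>} w (May a \<psi>)" "\<gamma> \<in> \<Gamma>" "forced {\<gamma>} w (Bang A)"
      using forced_singleton[OF may] forced_singleton[OF bang] by blast
    then have "satisfiable {\<beta>, \<gamma>}" using fin by simp
    moreover have "forced {\<beta>, \<gamma>} w (May a \<psi>)" "forced {\<beta>, \<gamma>} w (Bang A)"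
      using mono \<beta>\<gamma> by blast+
    ultimately show ?thesis by (rule forced_compatible)
  qed
  then have "cathoristic_model (canonical \<Gamma>) []" by (rule cathoristic_model_canonical)
  then show "satisfiable \<Gamma>"
    unfolding satisfiable_def by (blast intro: satisfies_canonical forced_member)
qed

end
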